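(* Any $132$-representable graph is a circle graph.
   Context: All graphs are finite and simple, and vertex labels are taken from a totally ordered set. For a finite word $w$, $A(w)$ is the set of letters occurring in $w$. Two distinct letters $x,y\in A(w)$ alternate in $w$ if deleting from $w$ all letters other than $x$ and $y$ leaves a word of the form $xyxy\cdots$ or $yxyx\cdots$ (of even or odd length). A word $w$ represents a graph $G=(V,E)$ if $A(w)=V$ and, for all $x\ne y$ in $V$, $x$ and $y$ alternate in $w$ if and only if $xy\in E$. A word $w=w_1\cdots w_m$ avoids the pattern $132$ (is $132$-avoiding) if there are no indices $i_1<i_2<i_3$ with $w_{i_1}<w_{i_3}<w_{i_2}$. A graph $G$ is $132$-representable if, possibly after relabelling its vertices by elements of a totally ordered set, there is a $132$-avoiding word that represents $G$. A circle graph is a graph whose vertices can be associated with chords of a circle such that two vertices are adjacent if and only if the corresponding chords intersect. *)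

theory Defs
  imports "HOL-Analysis.Analysis"
begin

definition fin_simple_graph :: "'a set \<Rightarrow> 'a set set \<Rightarrow> bool" where
  "fin_simple_graph V E \<longleftrightarrow>
     finite V \<and> (\<forall>e\<in>E. \<exists>x\<in>V. \<exists>y\<in>V. x \<noteq> y \<and> e = {x, y})"

text \<open>The word \<open>xyxy\<dots>\<close> of length \<open>n\<close>, starting with \<open>x\<close>.\<close>

definition alt_word :: "'a \<Rightarrow> 'a \<Rightarrow> nat \<Rightarrow> 'a list" where
  "alt_word x y n = map (\<lambda>i. if even i then x else y) [0..<n]"

definition alternate :: "'a list \<Rightarrow> 'a \<Rightarrow> 'a \<Rightarrow> bool" where
  "alternate w x y \<longleftrightarrow>
     (\<exists>n. filter (\<lambda>z. z = x \<or> z = y) w = alt_word x y n \<or>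
          filter (\<lambda>z. z = x \<or> z = y) w = alt_word y x n)"

definition represents :: "'a list \<Rightarrow> 'a set \<Rightarrow> 'a set set \<Rightarrow> bool" where
  "represents w V E \<longleftrightarrow>
     set w = V \<and> (\<forall>x\<in>V. \<forall>y\<in>V. x \<noteq> y \<longrightarrow> (alternate w x y \<longleftrightarrow> {x, y} \<in> E))"

definition avoids_132 :: "'b::linorder list \<Rightarrow> bool" where
  "avoids_132 w \<longleftrightarrow>
     \<not> (\<exists>i1 i2 i3. i1 < i2 \<and> i2 < i3 \<and> i3 < length w \<and>
          w ! i1 < w ! i3 \<and> w ! i3 < w ! i2)"

text \<open>The type argument is the totally ordered set from which the new labels are taken;
  results are to be stated for an arbitrary \<open>'b\<close>. The relabelling \<open>f\<close> carries
  the graph \<open>(V, E)\<close> to the isomorphic graph on \<open>f ` V\<close>.\<close>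

definition representable_132 :: "'b::linorder itself \<Rightarrow> 'a set \<Rightarrow> 'a set set \<Rightarrow> bool" where
  "representable_132 _ V E \<longleftrightarrow>
     (\<exists>(f :: 'a \<Rightarrow> 'b) (w :: 'b list).
        inj_on f V \<and> avoids_132 w \<and> represents w (f ` V) ((`) f ` E))"

text \<open>Chords are closed segments in the Euclidean plane, here \<^typ>\<open>complex\<close>, so chords with a
  common endpoint intersect.\<close>

definition chord :: "complex \<Rightarrow> real \<Rightarrow> complex set \<Rightarrow> bool" where
  "chord c r S \<longleftrightarrow>
     (\<exists>p q. p \<in> sphere c r \<and> q \<in> sphere c r \<and> p \<noteq> q \<and> S = closed_segment p q)"

definition circle_graph :: "'a set \<Rightarrow> 'a set set \<Rightarrow> bool" where
  "circle_graph V E \<longleftrightarrow>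
     (\<exists>c r. r > 0 \<and>
        (\<exists>C :: 'a \<Rightarrow> complex set.
           (\<forall>x\<in>V. chord c r (C x)) \<and>
           (\<forall>x\<in>V. \<forall>y\<in>V. x \<noteq> y \<longrightarrow> ({x, y} \<in> E \<longleftrightarrow> C x \<inter> C y \<noteq> {}))))"

end

theory Submission
  imports Defs "HOL-Library.Sublist"
begin

text \<open>
  In a 132-avoiding word, a letter \<open>x\<close> with at least three occurrences has at most one neighbour.
  Indeed, a neighbour of \<open>x\<close> occurs between any two successive occurrences of \<open>x\<close>, so for two
  neighbours \<open>a < b\<close> both \<open>x a x b x\<close> and \<open>x b x a x\<close> are scattered subwords. Wherever \<open>x\<close> lies
  relative to \<open>a\<close> and \<open>b\<close>, one of the two contains the pattern 132 (\<open>thrice_unique_neighbour\<close>).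

  Hence the letters with three or more occurrences can be deleted one at a time: each is an isolated or a pendant vertex of the graph that remains, and deletion preserves avoidance.
  What is left is a word in which every letter occurs at most twice. Putting its single letters in
  front once more, in their order of occurrence, makes every letter occur exactly twice without
  changing the graph (\<open>at_most_twice_two_uniform\<close>). The deleted vertices are then put back: a
  pendant vertex \<open>v\<close> with neighbour \<open>n\<close> by replacing one occurrence of \<open>n\<close> by \<open>v n v\<close>, an isolated
  one by appending \<open>v v\<close> (\<open>pendant_two_uniform\<close>).

  A word with every letter occurring exactly twice is a chord diagram: its positions are placed in
  order on a circle and every letter becomes the chord between its two positions. Two letters
  alternate if and only if their positions interleave, that is, if and only if their chords meet
  (\<open>alternate_iff_word_chords_meet\<close>).
\<close>

section \<open>Alternation\<close>

lemma alt_word_Suc: "alt_word x y (Suc n) = x # alt_word y x n"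
  unfolding alt_word_def by (simp add: upt_conv_Cons map_Suc_upt[symmetric] del: upt_Suc)

lemma distinct_adj_alt_word:
  assumes "x \<noteq> y"
  shows "distinct_adj (alt_word x y n)"
  using assms
proof (induction n arbitrary: x y)
  case 0
  then show ?case by (simp add: alt_word_def)
next
  case (Suc n)
  then show ?case
    by (cases n) (auto simp: alt_word_Suc, simp add: alt_word_def)
qed

lemma distinct_adj_eq_alt_word:
  assumes "distinct_adj (x # zs)" "set zs \<subseteq> {x, y}"
  shows "x # zs = alt_word x y (Suc (length zs))"
  using assms
proof (induction zs arbitrary: x y)
  case Nil
  then show ?case by (simp add: alt_word_def)
next
  case (Cons z zs)
  then have "z = y" by auto
  with Cons.prems Cons.IH[of y x] show ?case
    by (simp add: alt_word_Suc insert_commute)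
qed

text \<open>
  Over a two-letter alphabet, being of the form \<open>xyxy\<dots>\<close> is a local condition: no letter is
  repeated immediately. In this form alternation splits over concatenations.
\<close>

lemma alternate_iff_distinct_adj:
  assumes "x \<noteq> y"
  shows "alternate w x y \<longleftrightarrow> distinct_adj (filter (\<lambda>z. z = x \<or> z = y) w)"
proof
  assume "alternate w x y"
  then show "distinct_adj (filter (\<lambda>z. z = x \<or> z = y) w)"
    unfolding alternate_def using distinct_adj_alt_word assms by metis
next
  assume d: "distinct_adj (filter (\<lambda>z. z = x \<or> z = y) w)"
  show "alternate w x y"
  proof (cases "filter (\<lambda>z. z = x \<or> z = y) w")
    case Nil
    then have "filter (\<lambda>z. z = x \<or> z = y) w = alt_word x y 0"
      by (simp add: alt_word_def)
    then show ?thesis unfolding alternate_def by blast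
  next
    case (Cons z zs)
    have sub: "set (z # zs) \<subseteq> {x, y}"
      unfolding Cons[symmetric] by auto
    have d': "distinct_adj (z # zs)" using d unfolding Cons .
    from sub consider "z = x" | "z = y" by auto
    then show ?thesis
    proof cases
      case 1
      then have "z # zs = alt_word x y (Suc (length zs))"
        using d' sub by (auto intro!: distinct_adj_eq_alt_word)
      then show ?thesis unfolding alternate_def Cons by blast
    next
      case 2
      then have "z # zs = alt_word y x (Suc (length zs))"
        using d' sub by (auto intro!: distinct_adj_eq_alt_word)
      then show ?thesis unfolding alternate_def Cons by blast
    qed
  qed
qed

lemma alternate_commute: "alternate w x y \<longleftrightarrow> alternate w y x"
proof -
  have "(\<lambda>z. z = x \<or> z = y) = (\<lambda>z. z = y \<or> z = x)" by auto
  then show ?thesis unfolding alternate_def by (simp only:) blast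
qed

lemma alternate_between:
  assumes "alternate (p @ x # q @ x # r) x y" "x \<noteq> y"
  shows "y \<in> set q"
proof (rule ccontr)
  assume "y \<notin> set q"
  then have "set (filter (\<lambda>z. z = x \<or> z = y) q) \<subseteq> {x}" by auto
  then have "\<not> distinct_adj (x # filter (\<lambda>z. z = x \<or> z = y) q @ [x])"
    by (cases "filter (\<lambda>z. z = x \<or> z = y) q") auto
  moreover have "distinct_adj (filter (\<lambda>z. z = x \<or> z = y) (p @ (x # q @ [x]) @ r))"
    using assms by (simp add: alternate_iff_distinct_adj)
  then have "distinct_adj (filter (\<lambda>z. z = x \<or> z = y) (x # q @ [x]))"
    unfolding filter_append by (metis distinct_adj_appendD1 distinct_adj_appendD2)
  ultimately show False by simp
qed

section \<open>Letters occurring three times\<close>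

text \<open>
  Scattered subwords, unlike positions, survive the deletion of letters, so this is the form of
  avoidance that the induction carries along.
\<close>

lemma avoids_132_no_subseq:
  assumes "avoids_132 w" "subseq [a, c, b] w"
  shows "\<not> (a < b \<and> b < c)"
proof
  assume less: "a < b \<and> b < c"
  from assms(2) obtain p w1 where w: "w = p @ a # w1" and s1: "subseq [c, b] w1"
    by (blast dest: list_emb_ConsD)
  from s1 obtain q w2 where w1: "w1 = q @ c # w2" and s2: "subseq [b] w2"
    by (blast dest: list_emb_ConsD)
  from s2 obtain r s where w2: "w2 = r @ b # s"
    by (blast dest: list_emb_ConsD)
  let ?i = "length p" and ?j = "length p + 1 + length q"
    and ?k = "length p + 1 + length q + 1 + length r"
  have "w ! ?i = a" "w ! ?j = c" "w ! ?k = b" "?i < ?j" "?j < ?k" "?k < length w"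
    by (simp_all add: w w1 w2 nth_append)
  with less assms(1) show False
    unfolding avoids_132_def by blast
qed

lemma split_first:
  assumes "count_list w x = Suc n"
  obtains p q where "w = p @ x # q" "x \<notin> set p" "count_list q x = n"
proof -
  from assms have "x \<in> set w"
    by (metis count_list_0_iff nat.distinct(1))
  then obtain p q where "w = p @ x # q" "x \<notin> set p"
    by (meson split_list_first)
  with assms that show ?thesis by auto
qed

text \<open>
  Two neighbours \<open>a < b\<close> of \<open>x\<close> would each occur in both gaps between three occurrences of \<open>x\<close>. Then
  the word contains \<open>x b a\<close>, \<open>a b x\<close> and \<open>a x b\<close>, which have the pattern 132 when \<open>x\<close> is the
  smallest, the middle and the largest of the three letters, respectively.
\<close>

lemma thrice_unique_neighbour:
  fixes w :: "'b::linorder list"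
  assumes avoid: "\<And>a b c. subseq [a, c, b] w \<Longrightarrow> \<not> (a < b \<and> b < c)"
    and three: "3 \<le> count_list w x"
    and y: "alternate w x y" "x \<noteq> y"
    and z: "alternate w x z" "x \<noteq> z"
  shows "y = z"
proof -
  have no_two: False
    if ab: "a < b" and a: "alternate w x a" "x \<noteq> a" and b: "alternate w x b" "x \<noteq> b" for a b
  proof -
    obtain n where "count_list w x = Suc (Suc (Suc n))"
      using three by (metis Suc_le_D numeral_3_eq_3 Suc_le_mono)
    then obtain p q r s where w: "w = p @ x # q @ x # r @ x # s"
      by (metis split_first)
    have "a \<in> set q" "b \<in> set q"
      using alternate_between a b unfolding w by metis+
    moreover have "a \<in> set r" "b \<in> set r"
      using alternate_between[of "p @ x # q"] a b unfolding w by auto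
    ultimately have q: "subseq [a] q" "subseq [b] q" and r: "subseq [a] r" "subseq [b] r"
      by (auto simp: subseq_singleton_left)
    have in_gaps: "subseq ([x] @ [c] @ [x] @ [d] @ [x]) w"
      if "subseq [c] q" "subseq [d] r" for c d
    proof -
      have "subseq ([] @ [x] @ [c] @ [x] @ [d] @ [x] @ []) (p @ [x] @ q @ [x] @ r @ [x] @ s)"
        using that by (intro list_emb_append_mono) auto
      then show ?thesis by (simp add: w)
    qed
    consider "x < a" | "a < x" "x < b" | "b < x"
      using a b by fastforce
    then show False
    proof cases
      case 1
      have "subseq [x, b, a] w"
        by (rule subseq_order.trans[OF _ in_gaps[OF q(2) r(1)]]) simp
      with avoid 1 ab show False by blast
    next
      case 2
      have "subseq [a, b, x] w"
        using 2 by (intro subseq_order.trans[OF _ in_gaps[OF q(1) r(2)]]) simp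
      with avoid 2 show False by blast
    next
      case 3
      have "subseq [a, x, b] w"
        by (rule subseq_order.trans[OF _ in_gaps[OF q(1) r(2)]]) (use a in simp)
      with avoid 3 ab show False by blast
    qed
  qed
  then show ?thesis
    using y z by (metis neqE)
qed

section \<open>Reduction to words in which every letter occurs twice\<close>

definition two_uniform :: "'b list \<Rightarrow> bool" where
  "two_uniform u \<longleftrightarrow> (\<forall>x\<in>set u. count_list u x = 2)"

definition same_graph :: "'b list \<Rightarrow> 'b list \<Rightarrow> bool" where
  "same_graph u w \<longleftrightarrow> set u = set w \<and>
     (\<forall>x\<in>set w. \<forall>y\<in>set w. x \<noteq> y \<longrightarrow> alternate u x y = alternate w x y)"

lemma count_list_filter: "count_list (filter P w) x = (if P x then count_list w x else 0)"
  by (induction w) auto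

lemma filter_eq_replicate: "filter (\<lambda>z. z = x) w = replicate (count_list w x) x"
  by (induction w) auto

lemma length_filter_two:
  assumes "x \<noteq> y"
  shows "length (filter (\<lambda>z. z = x \<or> z = y) w) = count_list w x + count_list w y"
  using assms by (induction w) auto

text \<open>
  The new word is \<open>w\<close> preceded by its single letters in their order of occurrence. Two single
  letters turn \<open>xy\<close> into \<open>xyxy\<close>. A single \<open>x\<close> and a double \<open>y\<close> alternate in \<open>w\<close> only as \<open>yxy\<close>, which
  becomes \<open>xyxy\<close>; if they do not alternate, the repetition in \<open>w\<close> persists.
\<close>

lemma at_most_twice_two_uniform:
  assumes le2: "\<And>x. count_list w x \<le> 2"
  shows "\<exists>u. two_uniform u \<and> same_graph u w"
proof -
  let ?one = "\<lambda>z. count_list w z = 1"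
  let ?u = "filter ?one w @ w"
  have pos: "count_list w x = 1 \<or> count_list w x = 2" if "x \<in> set w" for x
    using le2[of x] that count_list_0_iff[of w x] by linarith
  have "two_uniform ?u"
    unfolding two_uniform_def using pos by (auto simp: count_list_filter)
  moreover have "alternate ?u x y = alternate w x y"
    if x: "x \<in> set w" and y: "y \<in> set w" and ne: "x \<noteq> y" for x y
  proof -
    have mixed: "alternate ?u a b = alternate w a b"
      if a: "count_list w a = 1" and b: "count_list w b = 2" and ne: "a \<noteq> b" for a b
    proof -
      let ?f = "filter (\<lambda>z. z = a \<or> z = b) w"
      have cnt: "count_list ?f a = 1" "count_list ?f b = 2"
        using a b by (simp_all add: count_list_filter)
      have "filter (\<lambda>z. z = a \<or> z = b) (filter ?one w) = filter (\<lambda>z. z = a) w"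
        using a b by (auto simp: intro!: filter_cong)
      also have "\<dots> = [a]"
        using filter_eq_replicate[of a w] a by simp
      finally have u: "filter (\<lambda>z. z = a \<or> z = b) ?u = a # ?f" by simp
      \<comment> \<open>If the single letter came first, the two occurrences of the other would be adjacent.\<close>
      have "hd ?f \<noteq> a" if d: "distinct_adj ?f"
      proof
        assume "hd ?f = a"
        then obtain g where g: "?f = a # g" using cnt by (cases ?f) auto
        moreover have "length ?f = 3" using a b ne by (simp add: length_filter_two)
        ultimately obtain c e where "g = [c, e]"
          by (auto simp: length_Suc_conv numeral_3_eq_3)
        then show False using cnt d ne unfolding g by (auto split: if_splits)
      qed
      then show ?thesis
        unfolding alternate_iff_distinct_adj[OF ne] u
        by (cases ?f) auto
    qed
    show ?thesis
      using pos[OF x] pos[OF y]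
    proof (elim disjE)
      assume c: "count_list w x = 1" "count_list w y = 1"
      let ?f = "filter (\<lambda>z. z = x \<or> z = y) w"
      have "length ?f = 2" "count_list ?f x = 1" "count_list ?f y = 1"
        using c ne by (simp_all add: length_filter_two count_list_filter)
      then have "?f = [x, y] \<or> ?f = [y, x]"
        using ne by (auto simp: length_Suc_conv numeral_2_eq_2 split: if_splits)
      moreover have "filter (\<lambda>z. z = x \<or> z = y) (filter ?one w) = ?f"
        using c by (auto intro!: filter_cong)
      ultimately show ?thesis
        unfolding alternate_iff_distinct_adj[OF ne] using ne by auto
    next
      assume c: "count_list w x = 2" "count_list w y = 2"
      then have "filter (\<lambda>z. z = x \<or> z = y) (filter ?one w) = []"
        by (auto simp: filter_empty_conv)
      then show ?thesis
        unfolding alternate_iff_distinct_adj[OF ne] by simp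
    qed (use mixed ne alternate_commute in metis)+
  qed
  ultimately show ?thesis
    unfolding same_graph_def by auto
qed

text \<open>
  One occurrence of the neighbour \<open>n\<close> of \<open>v\<close> becomes \<open>v n v\<close>; without a neighbour, \<open>v v\<close> is appended.
  In both cases the two new occurrences of \<open>v\<close> have at most the neighbour of \<open>v\<close> between
  them, so \<open>v\<close> alternates with no other letter. The second occurrence of \<open>n\<close> lies outside \<open>v n v\<close>,
  which gives \<open>nvnv\<close> or \<open>vnvn\<close>.
\<close>

lemma pendant_two_uniform:
  assumes u: "two_uniform u" "same_graph u (filter (\<lambda>z. z \<noteq> v) w)"
    and v: "v \<in> set w"
    and uniq: "\<And>y z. alternate w v y \<Longrightarrow> v \<noteq> y \<Longrightarrow> alternate w v z \<Longrightarrow> v \<noteq> z \<Longrightarrow> y = z"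
  shows "\<exists>u'. two_uniform u' \<and> same_graph u' w"
proof -
  have set_u: "set u = set w - {v}"
    using u by (auto simp: same_graph_def)
  have cnt: "count_list u x = (if x \<in> set w \<and> x \<noteq> v then 2 else 0)" for x
  proof (cases "x \<in> set u")
    case True
    then show ?thesis using u(1) set_u by (auto simp: two_uniform_def)
  next
    case False
    then show ?thesis using set_u by (auto simp: count_list_0_iff)
  qed
  have filter_w: "filter (\<lambda>z. z = x \<or> z = y) (filter (\<lambda>z. z \<noteq> v) w) = filter (\<lambda>z. z = x \<or> z = y) w"
    if "x \<noteq> v" "y \<noteq> v" for x y
    using that by (auto intro!: filter_cong)
  have old: "alternate u x y = alternate w x y"
    if "x \<in> set w" "y \<in> set w" "x \<noteq> y" "x \<noteq> v" "y \<noteq> v" for x y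
  proof -
    have "alternate u x y = alternate (filter (\<lambda>z. z \<noteq> v) w) x y"
      using u(2) that by (simp add: same_graph_def)
    also have "\<dots> = alternate w x y"
      unfolding alternate_def filter_w[OF that(4,5)] ..
    finally show ?thesis .
  qed
  \<comment> \<open>Whether two other letters alternate depends only on the word without \<open>v\<close>, so it suffices
    to insert \<open>v\<close> twice into \<open>u\<close> with the right neighbours.\<close>
  have extend: ?thesis
    if set: "set u' = set w" and two: "count_list u' v = 2"
      and rest: "filter (\<lambda>z. z \<noteq> v) u' = u"
      and new: "\<And>x. x \<in> set w \<Longrightarrow> x \<noteq> v \<Longrightarrow> alternate u' v x = alternate w v x" for u'
  proof -
    have "count_list u' x = 2" if "x \<in> set w" for x
    proof (cases "x = v")
      case False
      then have "count_list u' x = count_list u x"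
        unfolding rest[symmetric] by (simp add: count_list_filter)
      with that False show ?thesis by (simp add: cnt)
    qed (use two in simp)
    moreover have "alternate u' x y = alternate w x y"
      if xy: "x \<in> set w" "y \<in> set w" "x \<noteq> y" for x y
    proof -
      consider "x = v" | "y = v" | "x \<noteq> v" "y \<noteq> v" by blast
      then show ?thesis
      proof cases
        case 3
        have "filter (\<lambda>z. z = x \<or> z = y) u = filter (\<lambda>z. z = x \<or> z = y) u'"
          unfolding rest[symmetric] using 3 by (auto intro!: filter_cong)
        then have "alternate u' x y = alternate u x y"
          by (simp add: alternate_def)
        with old xy 3 show ?thesis by simp
      qed (use new xy alternate_commute in metis)+
    qed
    ultimately have "two_uniform u' \<and> same_graph u' w"
      using set by (simp add: two_uniform_def same_graph_def)
    then show ?thesis by blast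
  qed
  show ?thesis
  proof (cases "\<exists>n\<in>set w. n \<noteq> v \<and> alternate w v n")
    case False
    have "\<not> alternate (u @ [v, v]) v x" if "x \<noteq> v" for x
      using that alternate_between[of u v "[]" "[]" x] by auto
    then show ?thesis
      using False set_u v cnt[of v]
      by (intro extend[of "u @ [v, v]"]) (auto simp: filter_id_conv)
  next
    case True
    then obtain n where n: "n \<in> set w" "n \<noteq> v" "alternate w v n" by blast
    then obtain p q where pq: "u = p @ n # q"
      using set_u by (metis DiffI singletonD split_list)
    let ?u = "p @ [v, n, v] @ q"
    have vpq: "v \<notin> set p" "v \<notin> set q" using set_u pq by auto
    have "\<not> alternate ?u v x" if "x \<noteq> v" "x \<noteq> n" for x
      using that alternate_between[of p v "[n]" q x] by auto
    moreover have "alternate ?u v n"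
    proof -
      have "count_list p n + count_list q n = 1"
        using cnt[of n] n pq by simp
      then have c: "count_list p n = 0 \<and> count_list q n = 1 \<or> count_list p n = 1 \<and> count_list q n = 0"
        by linarith
      have "filter (\<lambda>z. z = v \<or> z = n) r = replicate (count_list r n) n"
        if "v \<notin> set r" for r
        using that by (induction r) auto
      with vpq c show ?thesis
        using n(2) by (auto simp: alternate_iff_distinct_adj)
    qed
    ultimately have "alternate ?u v x = alternate w v x" if "x \<in> set w" "x \<noteq> v" for x
      using uniq[of x n] n that by metis
    moreover have "set ?u = set w"
      using set_u v unfolding pq by auto
    moreover have "count_list ?u v = 2"
      using vpq n(2) by (simp add: count_list_0_iff)
    moreover have "filter (\<lambda>z. z \<noteq> v) ?u = u"
    proof -
      have "filter (\<lambda>z. z \<noteq> v) r = r" if "v \<notin> set r" for r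
        using that by (auto simp: filter_id_conv)
      with vpq n(2) show ?thesis by (simp add: pq)
    qed
    ultimately show ?thesis by (intro extend[of ?u])
  qed
qed

lemma avoiding_two_uniform:
  fixes w :: "'b::linorder list"
  assumes "\<And>a b c. subseq [a, c, b] w \<Longrightarrow> \<not> (a < b \<and> b < c)"
  shows "\<exists>u. two_uniform u \<and> same_graph u w"
  using assms
proof (induction w rule: length_induct)
  case (1 w)
  show ?case
  proof (cases "\<exists>v. 3 \<le> count_list w v")
    case False
    then have "count_list w x \<le> 2" for x
      by (metis Suc_le_eq not_less numeral_2_eq_2 numeral_3_eq_3)
    then show ?thesis by (rule at_most_twice_two_uniform)
  next
    case True
    then obtain v where v: "3 \<le> count_list w v" by blast
    then have vw: "v \<in> set w" by (metis count_list_0_iff not_numeral_le_zero)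
    let ?w = "filter (\<lambda>z. z \<noteq> v) w"
    have "length ?w < length w"
      using vw by (simp add: length_filter_less)
    moreover have "\<not> (a < b \<and> b < c)" if "subseq [a, c, b] ?w" for a b c
      using that "1.prems" subseq_order.trans[OF _ subseq_filter_left] by blast
    ultimately obtain u where "two_uniform u" "same_graph u ?w"
      using "1.IH" by blast
    then show ?thesis
      using vw thrice_unique_neighbour[OF "1.prems" v] by (rule pendant_two_uniform)
  qed
qed

section \<open>Chords of a two-uniform word\<close>

text \<open>
  The rational parametrisation of the unit circle without \<open>-1\<close>, which keeps all computations with
  chords polynomial; it runs through the circle in cyclic order as \<open>t\<close> increases.
\<close>

definition circle_point :: "real \<Rightarrow> complex" where
  "circle_point t = Complex ((1 - t\<^sup>2) / (1 + t\<^sup>2)) (2 * t / (1 + t\<^sup>2))"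

lemma one_plus_square_pos: "1 + t\<^sup>2 > (0::real)"
  by (simp add: add_pos_nonneg)

lemma circle_point_in_sphere: "circle_point t \<in> sphere 0 1"
proof -
  have "((1 - t\<^sup>2) / (1 + t\<^sup>2))\<^sup>2 + (2 * t / (1 + t\<^sup>2))\<^sup>2 = ((1 - t\<^sup>2)\<^sup>2 + (2 * t)\<^sup>2) / (1 + t\<^sup>2)\<^sup>2"
    by (simp add: power_divide add_divide_distrib)
  also have "(1 - t\<^sup>2)\<^sup>2 + (2 * t)\<^sup>2 = (1 + t\<^sup>2)\<^sup>2"
    by (simp add: power2_eq_square algebra_simps)
  finally show ?thesis
    using one_plus_square_pos[of t] by (simp add: circle_point_def cmod_def)
qed

text \<open>
  An affine function vanishing on the line through the circle points with parameters \<open>s\<close> and \<open>t\<close>;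
  for \<open>s = t\<close> the line is the tangent. It is positive at the circle points whose parameter lies
  strictly between \<open>s\<close> and \<open>t\<close>, and negative at those whose parameter lies outside.
\<close>

definition side :: "real \<Rightarrow> real \<Rightarrow> complex \<Rightarrow> real" where
  "side s t z = (1 - s * t) * Re z + (s + t) * Im z - (1 + s * t)"

lemma side_circle_point: "side s t (circle_point u) = - 2 * (u - s) * (u - t) / (1 + u\<^sup>2)"
proof -
  have "side s t (circle_point u)
      = ((1 - s * t) * (1 - u\<^sup>2) + (s + t) * (2 * u) - (1 + s * t) * (1 + u\<^sup>2)) / (1 + u\<^sup>2)"
    using one_plus_square_pos[of u]
    by (simp add: side_def circle_point_def divide_simps)
  also have "(1 - s * t) * (1 - u\<^sup>2) + (s + t) * (2 * u) - (1 + s * t) * (1 + u\<^sup>2)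
      = - 2 * (u - s) * (u - t)"
    by (simp add: algebra_simps power2_eq_square)
  finally show ?thesis .
qed

text \<open>
  The tangent at a point of the circle meets the circle nowhere else.
\<close>

lemma circle_point_inj: "s \<noteq> t \<Longrightarrow> circle_point s \<noteq> circle_point t"
proof
  assume "s \<noteq> t" "circle_point s = circle_point t"
  then have "side s s (circle_point t) = 0"
    by (metis side_circle_point diff_self mult_zero_right div_0 mult_eq_0_iff)
  with \<open>s \<noteq> t\<close> one_plus_square_pos[of t] show False
    by (simp add: side_circle_point)
qed

lemma side_convex_combination:
  "side s t ((1 - l) *\<^sub>R z + l *\<^sub>R z') = (1 - l) * side s t z + l * side s t z'"
  by (simp add: side_def algebra_simps)

text \<open>
  The hypothesis says that \<open>c\<close> and \<open>d\<close> are both strictly between \<open>a\<close> and \<open>b\<close> or both strictly outside.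
  Then the chord of \<open>c\<close> and \<open>d\<close> lies strictly on one side of the line that carries the other chord.
\<close>

lemma chords_same_side_disjoint:
  assumes "0 < (c - a) * (c - b) * ((d - a) * (d - b))"
  shows "closed_segment (circle_point a) (circle_point b)
    \<inter> closed_segment (circle_point c) (circle_point d) = {}"
proof (rule ccontr)
  assume "\<not> ?thesis"
  then obtain z where z: "z \<in> closed_segment (circle_point a) (circle_point b)"
    and z': "z \<in> closed_segment (circle_point c) (circle_point d)" by blast
  from z have zero: "side a b z = 0"
    unfolding in_segment by (auto simp: side_convex_combination side_circle_point)
  let ?C = "side a b (circle_point c)" and ?D = "side a b (circle_point d)"
  obtain l where l: "0 \<le> l" "l \<le> 1" "(1 - l) * ?C + l * ?D = 0"
    using z' zero unfolding in_segment by (metis side_convex_combination)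
  have "?C * ?D = 4 * ((c - a) * (c - b) * ((d - a) * (d - b))) / ((1 + c\<^sup>2) * (1 + d\<^sup>2))"
    unfolding side_circle_point times_divide_times_eq by (simp add: algebra_simps)
  with assms have "?C * ?D > 0"
    by (simp add: one_plus_square_pos)
  then consider "?C > 0" "?D > 0" | "?C < 0" "?D < 0"
    by (auto simp: zero_less_mult_iff)
  then show False
  proof cases
    case 1
    have "(1 - l) * ?C + l * ?D > 0"
    proof (cases "l = 0")
      case False
      with l 1 show ?thesis by (intro add_nonneg_pos mult_nonneg_nonneg mult_pos_pos) auto
    qed (use 1 in simp)
    with l show False by simp
  next
    case 2
    have "(1 - l) * - ?C + l * - ?D > 0"
    proof (cases "l = 0")
      case False
      with l 2 show ?thesis by (intro add_nonneg_pos mult_nonneg_nonneg mult_pos_pos) auto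
    qed (use 2 in simp)
    with l show False by simp
  qed
qed

lemma chords_apart_disjoint:
  assumes "a < b" "b < c" "c < d"
  shows "closed_segment (circle_point a) (circle_point b)
    \<inter> closed_segment (circle_point c) (circle_point d) = {}"
  using assms by (intro chords_same_side_disjoint mult_pos_pos) auto

lemma chords_nested_disjoint:
  assumes "a < b" "b < c" "c < d"
  shows "closed_segment (circle_point a) (circle_point d)
    \<inter> closed_segment (circle_point b) (circle_point c) = {}"
  using assms by (intro chords_same_side_disjoint mult_neg_neg mult_pos_neg) auto

lemma weighted_in_segment:
  fixes p q :: complex
  assumes "0 < m" "0 < n"
  shows "(1 / (m + n)) *\<^sub>R (m *\<^sub>R p + n *\<^sub>R q) \<in> closed_segment p q"
proof -
  have "1 - n / (m + n) = m / (m + n)"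
    using assms by (simp add: field_simps)
  then have "(1 / (m + n)) *\<^sub>R (m *\<^sub>R p + n *\<^sub>R q) = (1 - n / (m + n)) *\<^sub>R p + (n / (m + n)) *\<^sub>R q"
    by (simp add: scaleR_add_right)
  then show ?thesis
    using assms unfolding in_segment by (intro exI[of _ "n / (m + n)"]) auto
qed

text \<open>
  The third divided difference of a quadratic polynomial vanishes. Applied to \<open>1 + t\<^sup>2\<close>, \<open>1 - t\<^sup>2\<close> and
  \<open>2 t\<close> at the nodes \<open>a < b < c < d\<close>, this is an affine dependency between the four circle points. The
  signs of its coefficients alternate, so a positive combination of the points of \<open>a\<close> and \<open>c\<close> equals
  one of the points of \<open>b\<close> and \<open>d\<close> with the same total weight: the meeting point.
\<close>

lemma chords_interleaved_meet:
  assumes "a < b" "b < c" "c < d"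
  shows "closed_segment (circle_point a) (circle_point c)
    \<inter> closed_segment (circle_point b) (circle_point d) \<noteq> {}"
proof -
  \<comment> \<open>The absolute coefficients of the divided difference, multiplied by the Vandermonde determinant.\<close>
  define A where "A = (c - b) * (d - b) * (d - c)"
  define B where "B = (c - a) * (d - a) * (d - c)"
  define C where "C = (b - a) * (d - a) * (d - b)"
  define D where "D = (b - a) * (c - a) * (c - b)"
  have pos: "A > 0" "B > 0" "C > 0" "D > 0"
    using assms by (auto simp: A_def B_def C_def D_def)
  let ?w = "\<lambda>k t. k * (1 + t\<^sup>2)"
  have w: "?w k t *\<^sub>R circle_point t = Complex (k * (1 - t\<^sup>2)) (k * (2 * t))" for k t
    using one_plus_square_pos[of t] by (simp add: circle_point_def complex_eq_iff)
  have total: "?w A a + ?w C c = ?w B b + ?w D d"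
    by (simp add: A_def B_def C_def D_def algebra_simps power2_eq_square)
  have "A * (1 - a\<^sup>2) + C * (1 - c\<^sup>2) = B * (1 - b\<^sup>2) + D * (1 - d\<^sup>2)"
    and "A * (2 * a) + C * (2 * c) = B * (2 * b) + D * (2 * d)"
    by (simp_all add: A_def B_def C_def D_def algebra_simps power2_eq_square)
  then have moment: "?w A a *\<^sub>R circle_point a + ?w C c *\<^sub>R circle_point c
      = ?w B b *\<^sub>R circle_point b + ?w D d *\<^sub>R circle_point d"
    unfolding w by (simp add: complex_eq_iff)
  have "(1 / (?w A a + ?w C c)) *\<^sub>R (?w A a *\<^sub>R circle_point a + ?w C c *\<^sub>R circle_point c)
      \<in> closed_segment (circle_point a) (circle_point c)"
    using pos one_plus_square_pos by (intro weighted_in_segment mult_pos_pos) auto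
  moreover have "(1 / (?w A a + ?w C c)) *\<^sub>R (?w A a *\<^sub>R circle_point a + ?w C c *\<^sub>R circle_point c)
      \<in> closed_segment (circle_point b) (circle_point d)"
    unfolding total moment
    using pos one_plus_square_pos by (intro weighted_in_segment mult_pos_pos) auto
  ultimately show ?thesis by blast
qed

text \<open>
  Taking the convex hull avoids choosing an order of the two positions of \<open>x\<close>.
\<close>

definition word_chord :: "'b list \<Rightarrow> 'b \<Rightarrow> complex set" where
  "word_chord u x = convex hull ((\<lambda>i. circle_point (real i)) ` {i. i < length u \<and> u ! i = x})"

lemma filter_eq_map_nth:
  "filter P u = map ((!) u) (filter (\<lambda>i. P (u ! i)) [0..<length u])"
proof -
  have "filter P (map ((!) u) [0..<length u])
      = map ((!) u) (filter (\<lambda>i. P (u ! i)) [0..<length u])"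
    by (simp only: filter_map o_def)
  then show ?thesis by (simp only: map_nth)
qed

lemma word_chord_is_chord:
  assumes "count_list u x = 2"
  shows "chord 0 1 (word_chord u x)"
proof -
  let ?idx = "filter (\<lambda>i. u ! i = x) [0..<length u]"
  have "filter (\<lambda>z. z = x) u = map ((!) u) ?idx"
    by (rule filter_eq_map_nth)
  then have "length ?idx = 2"
    using assms by (metis filter_eq_replicate length_map length_replicate)
  then obtain i j where ij: "?idx = [i, j]"
    by (auto simp: length_Suc_conv numeral_2_eq_2)
  have "distinct ?idx" by simp
  then have "real i \<noteq> real j" unfolding ij by simp
  then have ne: "circle_point (real i) \<noteq> circle_point (real j)"
    by (rule circle_point_inj)
  have "{i. i < length u \<and> u ! i = x} = set ?idx" by auto
  then have "word_chord u x = closed_segment (circle_point (real i)) (circle_point (real j))"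
    unfolding word_chord_def ij by (simp add: segment_convex_hull)
  with ne show ?thesis
    unfolding chord_def using circle_point_in_sphere by blast
qed

text \<open>
  Listing the four positions of the two letters in increasing order leaves six arrangements. The
  alternating ones are those with interleaved chords; in the others the chords lie side by side or
  one behind the other.
\<close>

lemma alternate_iff_word_chords_meet:
  assumes x: "count_list u x = 2" and y: "count_list u y = 2" and ne: "x \<noteq> y"
  shows "alternate u x y \<longleftrightarrow> word_chord u x \<inter> word_chord u y \<noteq> {}"
proof -
  let ?P = "\<lambda>z. z = x \<or> z = y"
  let ?idx = "filter (\<lambda>i. ?P (u ! i)) [0..<length u]"
  have f: "filter ?P u = map ((!) u) ?idx" by (rule filter_eq_map_nth)
  have len: "length ?idx = 4"
    using length_filter_two[OF ne, of u] x y unfolding f by simp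
  then obtain i j k l where idx: "?idx = [i, j, k, l]"
    by (auto simp: length_Suc_conv eval_nat_numeral)
  have "sorted_wrt (<) ?idx" by (intro sorted_wrt_filter) simp
  then have less: "i < j" "j < k" "k < l" unfolding idx by auto
  have pos: "{m. m < length u \<and> ?P (u ! m)} = {i, j, k, l}"
    using arg_cong[OF idx, of set] by auto
  have pos_x: "{m. m < length u \<and> u ! m = x} = {m \<in> {i, j, k, l}. u ! m = x}"
    and pos_y: "{m. m < length u \<and> u ! m = y} = {m \<in> {i, j, k, l}. u ! m = y}"
    unfolding pos[symmetric] by auto
  have letters: "?P (u ! i)" "?P (u ! j)" "?P (u ! k)" "?P (u ! l)"
    using pos by blast+
  have cx: "count_list [u ! i, u ! j, u ! k, u ! l] x = 2"
    and cy: "count_list [u ! i, u ! j, u ! k, u ! l] y = 2"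
    using x y arg_cong[OF f, of "\<lambda>v. count_list v x"] arg_cong[OF f, of "\<lambda>v. count_list v y"]
    unfolding idx by (simp_all add: count_list_filter)
  let ?seg = "\<lambda>m n. closed_segment (circle_point (real m)) (circle_point (real n))"
  have chord_x: "word_chord u x = ?seg m n"
    if "{m' \<in> {i, j, k, l}. u ! m' = x} = {m, n}" for m n
    unfolding word_chord_def pos_x that by (simp add: segment_convex_hull)
  have chord_y: "word_chord u y = ?seg m n"
    if "{m' \<in> {i, j, k, l}. u ! m' = y} = {m, n}" for m n
    unfolding word_chord_def pos_y that by (simp add: segment_convex_hull)
  have alt: "alternate u x y \<longleftrightarrow> distinct_adj [u ! i, u ! j, u ! k, u ! l]"
    unfolding alternate_iff_distinct_adj[OF ne] f idx by simp
  have real_less: "real i < real j" "real j < real k" "real k < real l"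
    using less by auto
  note disjoint = chords_apart_disjoint[OF real_less] chords_nested_disjoint[OF real_less]
  note meet = chords_interleaved_meet[OF real_less]
  consider
      (apart) "u ! i = x" "u ! j = x" "u ! k = y" "u ! l = y"
    | (apart') "u ! i = y" "u ! j = y" "u ! k = x" "u ! l = x"
    | (nested) "u ! i = x" "u ! j = y" "u ! k = y" "u ! l = x"
    | (nested') "u ! i = y" "u ! j = x" "u ! k = x" "u ! l = y"
    | (interleaved) "u ! i = x" "u ! j = y" "u ! k = x" "u ! l = y"
    | (interleaved') "u ! i = y" "u ! j = x" "u ! k = y" "u ! l = x"
    using letters cx cy ne by (auto split: if_splits)
  then show ?thesis
  proof cases
    case apart
    have "word_chord u x = ?seg i j" by (rule chord_x) (use apart ne in auto)
    moreover have "word_chord u y = ?seg k l" by (rule chord_y) (use apart ne in auto)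
    ultimately show ?thesis
      using apart alt disjoint ne by (simp add: Int_commute)
  next
    case apart'
    have "word_chord u y = ?seg i j" by (rule chord_y) (use apart' ne in auto)
    moreover have "word_chord u x = ?seg k l" by (rule chord_x) (use apart' ne in auto)
    ultimately show ?thesis
      using apart' alt disjoint ne by (simp add: Int_commute)
  next
    case nested
    have "word_chord u x = ?seg i l" by (rule chord_x) (use nested ne in auto)
    moreover have "word_chord u y = ?seg j k" by (rule chord_y) (use nested ne in auto)
    ultimately show ?thesis
      using nested alt disjoint ne by (simp add: Int_commute)
  next
    case nested'
    have "word_chord u y = ?seg i l" by (rule chord_y) (use nested' ne in auto)
    moreover have "word_chord u x = ?seg j k" by (rule chord_x) (use nested' ne in auto)
    ultimately show ?thesis
      using nested' alt disjoint ne by (simp add: Int_commute)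
  next
    case interleaved
    have "word_chord u x = ?seg i k" by (rule chord_x) (use interleaved ne in auto)
    moreover have "word_chord u y = ?seg j l" by (rule chord_y) (use interleaved ne in auto)
    ultimately show ?thesis
      using interleaved alt meet ne by (simp add: Int_commute)
  next
    case interleaved'
    have "word_chord u y = ?seg i k" by (rule chord_y) (use interleaved' ne in auto)
    moreover have "word_chord u x = ?seg j l" by (rule chord_x) (use interleaved' ne in auto)
    ultimately show ?thesis
      using interleaved' alt meet ne by (simp add: Int_commute)
  qed
qed

lemma two_uniform_circle_graph:
  fixes f :: "'a \<Rightarrow> 'b"
  assumes u: "two_uniform u" "set u = f ` V"
    and edge: "\<And>x y. x \<in> V \<Longrightarrow> y \<in> V \<Longrightarrow> x \<noteq> y \<Longrightarrow> {x, y} \<in> E \<longleftrightarrow> alternate u (f x) (f y)"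
    and inj: "inj_on f V"
  shows "circle_graph V E"
proof -
  let ?C = "\<lambda>x. word_chord u (f x)"
  have two: "count_list u (f x) = 2" if "x \<in> V" for x
    using u that by (auto simp: two_uniform_def)
  have chords: "\<forall>x\<in>V. chord 0 1 (?C x)"
    by (intro ballI word_chord_is_chord two)
  have meet: "{x, y} \<in> E \<longleftrightarrow> ?C x \<inter> ?C y \<noteq> {}"
    if "x \<in> V" "y \<in> V" "x \<noteq> y" for x y
  proof -
    have "f x \<noteq> f y" using that inj by (meson inj_onD)
    with that show ?thesis
      by (simp add: edge two alternate_iff_word_chords_meet)
  qed
  have "\<forall>x\<in>V. \<forall>y\<in>V. x \<noteq> y \<longrightarrow> ({x, y} \<in> E \<longleftrightarrow> ?C x \<inter> ?C y \<noteq> {})"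
    by (intro ballI impI meet)
  with chords have "(0::real) < 1 \<and> (\<exists>C. (\<forall>x\<in>V. chord 0 1 (C x)) \<and>
      (\<forall>x\<in>V. \<forall>y\<in>V. x \<noteq> y \<longrightarrow> ({x, y} \<in> E \<longleftrightarrow> C x \<inter> C y \<noteq> {})))"
    by (intro conjI exI[of _ ?C]) simp_all
  then show ?thesis
    unfolding circle_graph_def by (intro exI[of _ "0::complex"] exI[of _ "1::real"])
qed

theorem corollary3p5:
  fixes V :: "'a set" and E :: "'a set set"
  assumes "fin_simple_graph V E"
    and "representable_132 TYPE('b::linorder) V E"
  shows "circle_graph V E"
proof -
  obtain f :: "'a \<Rightarrow> 'b" and w where inj: "inj_on f V" and avoid: "avoids_132 w"
    and rep: "represents w (f ` V) ((`) f ` E)"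
    using assms(2) unfolding representable_132_def by blast
  have "\<exists>u. two_uniform u \<and> same_graph u w"
    by (rule avoiding_two_uniform) (rule avoids_132_no_subseq[OF avoid])
  then obtain u where u: "two_uniform u" "same_graph u w" by blast
  have edge: "{x, y} \<in> E \<longleftrightarrow> alternate u (f x) (f y)" if xy: "x \<in> V" "y \<in> V" "x \<noteq> y" for x y
  proof -
    have "inj_on ((`) f) (Pow V)" using inj by (rule inj_on_image_Pow)
    moreover have "{x, y} \<in> Pow V" using xy by simp
    moreover have "E \<subseteq> Pow V"
      using assms(1) by (fastforce simp: fin_simple_graph_def)
    ultimately have "f ` {x, y} \<in> (`) f ` E \<longleftrightarrow> {x, y} \<in> E"
      by (rule inj_on_image_mem_iff)
    then have "{x, y} \<in> E \<longleftrightarrow> {f x, f y} \<in> (`) f ` E" by simp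
    moreover have ne: "f x \<noteq> f y" using xy inj by (meson inj_onD)
    then have "alternate w (f x) (f y) \<longleftrightarrow> {f x, f y} \<in> (`) f ` E"
      using rep xy(1,2) by (simp add: represents_def)
    moreover have "alternate u (f x) (f y) \<longleftrightarrow> alternate w (f x) (f y)"
      using rep u(2) xy(1,2) ne by (simp add: represents_def same_graph_def)
    ultimately show ?thesis by simp
  qed
  have "set u = f ` V"
    using rep u(2) by (simp add: represents_def same_graph_def)
  then show ?thesis
    using edge inj by (rule two_uniform_circle_graph[OF u(1)])
qed

end
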